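(* Let $\mathcal{A}$ be a finite poset (regarded as a category) with objects $a_1,\dots,a_m$, and let $F:\mathcal{A}\rightarrow\mathbf{Cat}$ be a pseudofunctor such that for every object $a$ in $\mathcal{A}$ the category $F(a)$ is finite. Assume that for every object $a$ in $\mathcal{A}$, the matrix $[F(a)]$ has a weighting. Then $$\chi(G(F))=\chi(F)\,[\mathcal{A}]^+\,\mathbf{1}_{|\mathcal{A}|},$$ where $\chi(F)$ is the $1\times m$-matrix $[\,\chi(F(a_1))\ \chi(F(a_2))\ \cdots\ \chi(F(a_m))\,]$ and $G(F)$ is the Grothendieck construction of $F$.
   Context: A finite category is a category with finitely many objects and finitely many morphisms. All matrices have entries in $\mathbb{Q}$, and $M^*$ denotes the transpose of $M$. The Moore–Penrose inverse of an $m\times n$-matrix $M$ is the unique $n\times m$-matrix $M^+$ satisfying $MM^+M=M$, $M^+MM^+=M^+$, $(M^+M)^*=M^+M$, $(MM^+)^*=MM^+$. $\mathbf{1}_m$ denotes the $m\times 1$-matrix all of whose entries are $1$. For a finite category $\mathcal{C}$ with object set $\{c_1,\dots,c_m\}$, $|\mathcal{C}|=m$ is the number of objects and $[\mathcal{C}]$ is the $m\times m$-matrix whose $ij$-th entry is the number of elements of the morphism set $\mathcal{C}(c_i,c_j)$. Define $\chi(\mathcal{C})=\mathbf{1}_{|\mathcal{C}|}^*[\mathcal{C}]^+\mathbf{1}_{|\mathcal{C}|}$, a $1\times 1$-matrix regarded as a rational number (independent of the order of the objects). An $n\times 1$-matrix $w$ is a weighting for an $m\times n$-matrix $M$ if $Mw=\mathbf{1}_m$.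 For a pseudofunctor $F:\mathcal{A}\to\mathbf{Cat}$, the Grothendieck construction $G(F)$ is the category whose objects are the pairs $(a,x)$ with $a$ an object of $\mathcal{A}$ and $x$ an object of $F(a)$, and whose morphisms from $(a,x)$ to $(b,y)$ are the pairs $(f,\zeta)$ with $f:a\to b$ a morphism in $\mathcal{A}$ and $\zeta:F(f)(x)\to y$ a morphism in $F(b)$. The order of the objects of $\mathcal{A}$ used in $[\mathcal{A}]$ is the same as the one used in $\chi(F)$. *)

theory Defs
  imports "Jordan_Normal_Form.Matrix"
begin

section \<open>Categories, functors and natural isomorphisms\<close>

text \<open>
  A category is given by its objects and a family of hom-sets. The hom-sets are not required to
  be disjoint (the morphisms \<open>(f, \<zeta>)\<close> of a Grothendieck construction do not determine their
  source), so identities, composition and the action of a functor on morphisms carry the objects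
  involved as arguments: \<open>cat_comp C x y z g f\<close> is the composite of \<open>f : x \<rightarrow> y\<close> and
  \<open>g : y \<rightarrow> z\<close>. Values outside of the carrier are irrelevant.
\<close>

record ('o, 'm) cat =
  Obj :: "'o set"
  Hom :: "'o \<Rightarrow> 'o \<Rightarrow> 'm set"
  Idt :: "'o \<Rightarrow> 'm"
  cat_comp :: "'o \<Rightarrow> 'o \<Rightarrow> 'o \<Rightarrow> 'm \<Rightarrow> 'm \<Rightarrow> 'm"

locale category =
  fixes C :: "('o, 'm) cat"
  assumes id_in_hom:
      "x \<in> Obj C \<Longrightarrow> Idt C x \<in> Hom C x x"
    and comp_in_hom:
      "\<lbrakk>x \<in> Obj C; y \<in> Obj C; z \<in> Obj C; f \<in> Hom C x y; g \<in> Hom C y z\<rbrakk>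
        \<Longrightarrow> cat_comp C x y z g f \<in> Hom C x z"
    and comp_id_right:
      "\<lbrakk>x \<in> Obj C; y \<in> Obj C; f \<in> Hom C x y\<rbrakk> \<Longrightarrow> cat_comp C x x y f (Idt C x) = f"
    and comp_id_left:
      "\<lbrakk>x \<in> Obj C; y \<in> Obj C; f \<in> Hom C x y\<rbrakk> \<Longrightarrow> cat_comp C x y y (Idt C y) f = f"
    and comp_assoc:
      "\<lbrakk>w \<in> Obj C; x \<in> Obj C; y \<in> Obj C; z \<in> Obj C;
        f \<in> Hom C w x; g \<in> Hom C x y; h \<in> Hom C y z\<rbrakk>
        \<Longrightarrow> cat_comp C w x z (cat_comp C x y z h g) f
            = cat_comp C w y z h (cat_comp C w x y g f)"

locale finite_category = category +
  assumes finite_objects: "finite (Obj C)"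
    and finite_morphisms: "finite {(x, y, f). x \<in> Obj C \<and> y \<in> Obj C \<and> f \<in> Hom C x y}"

definition iso_pair :: "('o, 'm) cat \<Rightarrow> 'o \<Rightarrow> 'o \<Rightarrow> 'm \<Rightarrow> 'm \<Rightarrow> bool" where
  "iso_pair C x y f g \<longleftrightarrow> f \<in> Hom C x y \<and> g \<in> Hom C y x \<and>
     cat_comp C x y x g f = Idt C x \<and> cat_comp C y x y f g = Idt C y"

definition isomorphism :: "('o, 'm) cat \<Rightarrow> 'o \<Rightarrow> 'o \<Rightarrow> 'm \<Rightarrow> bool" where
  "isomorphism C x y f \<longleftrightarrow> (\<exists>g. iso_pair C x y f g)"

record ('o, 'm, 'p, 'n) func =
  on_obj :: "'o \<Rightarrow> 'p"
  on_hom :: "'o \<Rightarrow> 'o \<Rightarrow> 'm \<Rightarrow> 'n"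

locale cat_functor = source: category C + target: category D
  for C :: "('o, 'm) cat" and D :: "('p, 'n) cat" +
  fixes F :: "('o, 'm, 'p, 'n) func"
  assumes obj_in: "x \<in> Obj C \<Longrightarrow> on_obj F x \<in> Obj D"
    and hom_in: "\<lbrakk>x \<in> Obj C; y \<in> Obj C; f \<in> Hom C x y\<rbrakk>
        \<Longrightarrow> on_hom F x y f \<in> Hom D (on_obj F x) (on_obj F y)"
    and preserves_id: "x \<in> Obj C \<Longrightarrow> on_hom F x x (Idt C x) = Idt D (on_obj F x)"
    and preserves_comp:
      "\<lbrakk>x \<in> Obj C; y \<in> Obj C; z \<in> Obj C; f \<in> Hom C x y; g \<in> Hom C y z\<rbrakk>
        \<Longrightarrow> on_hom F x z (cat_comp C x y z g f)
            = cat_comp D (on_obj F x) (on_obj F y) (on_obj F z) (on_hom F y z g) (on_hom F x y f)"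

definition id_func :: "('o, 'm, 'o, 'm) func" where
  "id_func = \<lparr>on_obj = (\<lambda>x. x), on_hom = (\<lambda>x y f. f)\<rparr>"

definition comp_func ::
    "('p, 'n, 'q, 'k) func \<Rightarrow> ('o, 'm, 'p, 'n) func \<Rightarrow> ('o, 'm, 'q, 'k) func" where
  "comp_func G F = \<lparr>on_obj = (\<lambda>x. on_obj G (on_obj F x)),
     on_hom = (\<lambda>x y f. on_hom G (on_obj F x) (on_obj F y) (on_hom F x y f))\<rparr>"

locale natural_isomorphism = F: cat_functor C D F + G: cat_functor C D G
  for C :: "('o, 'm) cat" and D :: "('p, 'n) cat"
    and F :: "('o, 'm, 'p, 'n) func" and G :: "('o, 'm, 'p, 'n) func" +
  fixes t :: "'o \<Rightarrow> 'n"
  assumes component_iso: "x \<in> Obj C \<Longrightarrow> isomorphism D (on_obj F x) (on_obj G x) (t x)"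
    and naturality: "\<lbrakk>x \<in> Obj C; y \<in> Obj C; f \<in> Hom C x y\<rbrakk>
        \<Longrightarrow> cat_comp D (on_obj F x) (on_obj F y) (on_obj G y) (t y) (on_hom F x y f)
            = cat_comp D (on_obj F x) (on_obj G x) (on_obj G y) (on_hom G x y f) (t x)"


section \<open>Pseudofunctors to Cat and the Grothendieck construction\<close>

text \<open>
  The structure isomorphisms of a pseudofunctor \<open>F\<close> are oriented as
  \<open>F(g \<circ> f) \<Rightarrow> F(g) \<circ> F(f)\<close> (\<open>compositor\<close>) and \<open>F(1) \<Rightarrow> 1\<close> (\<open>unitor\<close>), which is the direction
  in which they enter the Grothendieck construction; as they are invertible, the opposite
  orientation gives the same notion. All categories \<open>F(a)\<close> share one type of objects and
  one type of morphisms, but no relation between their carriers is assumed.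
\<close>

record ('a, 'f, 'o, 'm) pseudofunc =
  cat_at :: "'a \<Rightarrow> ('o, 'm) cat"
  func_at :: "'a \<Rightarrow> 'a \<Rightarrow> 'f \<Rightarrow> ('o, 'm, 'o, 'm) func"
  unitor :: "'a \<Rightarrow> 'o \<Rightarrow> 'm"
  compositor :: "'a \<Rightarrow> 'a \<Rightarrow> 'a \<Rightarrow> 'f \<Rightarrow> 'f \<Rightarrow> 'o \<Rightarrow> 'm"

locale pseudofunctor = base: category A
  for A :: "('a, 'f) cat" and F :: "('a, 'f, 'o, 'm) pseudofunc" +
  assumes category_at: "a \<in> Obj A \<Longrightarrow> category (cat_at F a)"
    and functor_at: "\<lbrakk>a \<in> Obj A; b \<in> Obj A; f \<in> Hom A a b\<rbrakk>
        \<Longrightarrow> cat_functor (cat_at F a) (cat_at F b) (func_at F a b f)"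
    and unitor_natural_iso: "a \<in> Obj A
        \<Longrightarrow> natural_isomorphism (cat_at F a) (cat_at F a)
              (func_at F a a (Idt A a)) id_func (unitor F a)"
    and compositor_natural_iso:
      "\<lbrakk>a \<in> Obj A; b \<in> Obj A; c \<in> Obj A; f \<in> Hom A a b; g \<in> Hom A b c\<rbrakk>
        \<Longrightarrow> natural_isomorphism (cat_at F a) (cat_at F c)
              (func_at F a c (cat_comp A a b c g f))
              (comp_func (func_at F b c g) (func_at F a b f))
              (compositor F a b c g f)"
    \<comment> \<open>\<open>F f = F (f \<circ> 1) \<Rightarrow> F f \<circ> F 1 \<Rightarrow> F f\<close> is the identity\<close>
    and unit_right:
      "\<lbrakk>a \<in> Obj A; b \<in> Obj A; f \<in> Hom A a b; x \<in> Obj (cat_at F a)\<rbrakk>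
        \<Longrightarrow> cat_comp (cat_at F b)
              (on_obj (func_at F a b f) x)
              (on_obj (func_at F a b f) (on_obj (func_at F a a (Idt A a)) x))
              (on_obj (func_at F a b f) x)
              (on_hom (func_at F a b f) (on_obj (func_at F a a (Idt A a)) x) x (unitor F a x))
              (compositor F a a b f (Idt A a) x)
            = Idt (cat_at F b) (on_obj (func_at F a b f) x)"
    \<comment> \<open>\<open>F f = F (1 \<circ> f) \<Rightarrow> F 1 \<circ> F f \<Rightarrow> F f\<close> is the identity\<close>
    and unit_left:
      "\<lbrakk>a \<in> Obj A; b \<in> Obj A; f \<in> Hom A a b; x \<in> Obj (cat_at F a)\<rbrakk>
        \<Longrightarrow> cat_comp (cat_at F b)
              (on_obj (func_at F a b f) x)
              (on_obj (func_at F b b (Idt A b)) (on_obj (func_at F a b f) x))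
              (on_obj (func_at F a b f) x)
              (unitor F b (on_obj (func_at F a b f) x))
              (compositor F a b b (Idt A b) f x)
            = Idt (cat_at F b) (on_obj (func_at F a b f) x)"
    \<comment> \<open>the two composites \<open>F (h \<circ> g \<circ> f) \<Rightarrow> F h \<circ> F g \<circ> F f\<close> agree\<close>
    and associativity:
      "\<lbrakk>a \<in> Obj A; b \<in> Obj A; c \<in> Obj A; d \<in> Obj A;
        f \<in> Hom A a b; g \<in> Hom A b c; h \<in> Hom A c d; x \<in> Obj (cat_at F a)\<rbrakk>
        \<Longrightarrow> cat_comp (cat_at F d)
              (on_obj (func_at F a d (cat_comp A a c d h (cat_comp A a b c g f))) x)
              (on_obj (func_at F c d h) (on_obj (func_at F a c (cat_comp A a b c g f)) x))
              (on_obj (func_at F c d h) (on_obj (func_at F b c g) (on_obj (func_at F a b f) x)))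
              (on_hom (func_at F c d h)
                 (on_obj (func_at F a c (cat_comp A a b c g f)) x)
                 (on_obj (func_at F b c g) (on_obj (func_at F a b f) x))
                 (compositor F a b c g f x))
              (compositor F a c d h (cat_comp A a b c g f) x)
            = cat_comp (cat_at F d)
              (on_obj (func_at F a d (cat_comp A a c d h (cat_comp A a b c g f))) x)
              (on_obj (func_at F b d (cat_comp A b c d h g)) (on_obj (func_at F a b f) x))
              (on_obj (func_at F c d h) (on_obj (func_at F b c g) (on_obj (func_at F a b f) x)))
              (compositor F b c d h g (on_obj (func_at F a b f) x))
              (compositor F a b d (cat_comp A b c d h g) f x)"

text \<open>
  The composite of \<open>(f, \<zeta>) : (a, x) \<rightarrow> (b, y)\<close> and \<open>(g, \<xi>) : (b, y) \<rightarrow> (c, z)\<close> is \<open>g \<circ> f\<close> together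
  with \<open>F(g \<circ> f) x \<rightarrow> F(g) (F(f) x) \<rightarrow> F(g) y \<rightarrow> z\<close>.
\<close>

definition grothendieck ::
    "('a, 'f) cat \<Rightarrow> ('a, 'f, 'o, 'm) pseudofunc \<Rightarrow> ('a \<times> 'o, 'f \<times> 'm) cat" where
  "grothendieck A F = \<lparr>
     Obj = {(a, x). a \<in> Obj A \<and> x \<in> Obj (cat_at F a)},
     Hom = (\<lambda>(a, x) (b, y). {(f, \<zeta>). f \<in> Hom A a b \<and>
              \<zeta> \<in> Hom (cat_at F b) (on_obj (func_at F a b f) x) y}),
     Idt = (\<lambda>(a, x). (Idt A a, unitor F a x)),
     cat_comp = (\<lambda>(a, x) (b, y) (c, z) (g, \<xi>) (f, \<zeta>).
       (cat_comp A a b c g f,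
        cat_comp (cat_at F c)
          (on_obj (func_at F a c (cat_comp A a b c g f)) x)
          (on_obj (func_at F b c g) y)
          z
          \<xi>
          (cat_comp (cat_at F c)
            (on_obj (func_at F a c (cat_comp A a b c g f)) x)
            (on_obj (func_at F b c g) (on_obj (func_at F a b f) x))
            (on_obj (func_at F b c g) y)
            (on_hom (func_at F b c g) (on_obj (func_at F a b f) x) y \<zeta>)
            (compositor F a b c g f x))))\<rparr>"

definition poset_category :: "'a set \<Rightarrow> ('a \<times> 'a) set \<Rightarrow> ('a, 'a \<times> 'a) cat" where
  "poset_category P r = \<lparr>
     Obj = P,
     Hom = (\<lambda>a b. {e. e = (a, b) \<and> (a, b) \<in> r}),
     Idt = (\<lambda>a. (a, a)),
     cat_comp = (\<lambda>a b c g f. (a, c))\<rparr>"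

lemma category_poset_category:
  assumes "partial_order_on P r"
  shows "category (poset_category P r)"
  using assms
  by unfold_locales
    (auto simp: poset_category_def partial_order_on_def preorder_on_def refl_on_def
          elim: transE)


section \<open>The Moore--Penrose inverse and the Euler characteristic\<close>

definition is_mp_inverse :: "rat mat \<Rightarrow> rat mat \<Rightarrow> bool" where
  "is_mp_inverse M N \<longleftrightarrow> N \<in> carrier_mat (dim_col M) (dim_row M) \<and>
     M * N * M = M \<and> N * M * N = N \<and>
     transpose_mat (N * M) = N * M \<and> transpose_mat (M * N) = M * N"

definition mp_inverse :: "rat mat \<Rightarrow> rat mat" where
  "mp_inverse M = (THE N. is_mp_inverse M N)"

definition ones :: "nat \<Rightarrow> rat mat" where
  "ones m = mat m 1 (\<lambda>_. 1)"

definition weighting :: "rat mat \<Rightarrow> rat mat \<Rightarrow> bool" where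
  "weighting M w \<longleftrightarrow> w \<in> carrier_mat (dim_col M) 1 \<and> M * w = ones (dim_row M)"

definition hom_matrix :: "('o, 'm) cat \<Rightarrow> 'o list \<Rightarrow> rat mat" where
  "hom_matrix C xs =
     mat (length xs) (length xs) (\<lambda>(i, j). of_nat (card (Hom C (xs ! i) (xs ! j))))"

definition enumerates :: "'o list \<Rightarrow> 'o set \<Rightarrow> bool" where
  "enumerates xs S \<longleftrightarrow> distinct xs \<and> set xs = S"

text \<open>
  Neither the Euler characteristic nor the existence of a weighting depends on the order of the
  objects; an arbitrary enumeration of a finite category is fixed for both.
\<close>

definition obj_list :: "('o, 'm) cat \<Rightarrow> 'o list" where
  "obj_list C = (SOME xs. enumerates xs (Obj C))"

definition euler_char :: "('o, 'm) cat \<Rightarrow> rat" where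
  "euler_char C = (transpose_mat (ones (card (Obj C))) * mp_inverse (hom_matrix C (obj_list C))
     * ones (card (Obj C))) $$ (0, 0)"

definition euler_char_row :: "('a, 'f, 'o, 'm) pseudofunc \<Rightarrow> 'a list \<Rightarrow> rat mat" where
  "euler_char_row F as = mat 1 (length as) (\<lambda>(i, j). euler_char (cat_at F (as ! j)))"

end

theory Submission
  imports Defs "HOL-Library.Function_Algebras"
begin

text \<open>
  If a matrix \<open>M\<close> has a weighting, then \<open>M\<^sup>+ 1\<close> is again a weighting, and it is orthogonal to the
  kernel of \<open>M\<close> because the columns of \<open>M\<^sup>+\<close> lie in the row space of \<open>M\<close>. These two properties
  determine it, since two such weightings differ by an element of the kernel that is orthogonal
  to itself. Call it the least weighting. Thus \<open>\<chi>(C)\<close> is the sum of the entries of the least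
  weighting of \<open>[C]\<close>, and to compute \<open>\<chi>(G(F))\<close> it suffices to exhibit the least weighting of
  \<open>[G(F)]\<close>.

  Let \<open>w = [A]\<^sup>+ 1\<close>, which is a weighting of \<open>[A]\<close> since the unitriangular matrix of a finite poset
  has one, and let \<open>u\<^sub>b\<close> be the least weighting of \<open>[F(b)]\<close>. The function \<open>(b, y) \<mapsto> w(b) u\<^sub>b(y)\<close> is the
  least weighting of \<open>[G(F)]\<close> (\<open>least_weighting_grothendieck\<close>), and its entries add up to
  \<open>\<Sum>\<^sub>b w(b) \<chi>(F(b))\<close>, the right-hand side of the theorem. That it is a weighting is a direct
  computation: row \<open>(a, x)\<close> of \<open>[G(F)]\<close> is a row of \<open>[F(b)]\<close> over each \<open>b \<ge> a\<close> and zero elsewhere. That it is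
  orthogonal to the kernel rests on the order of \<open>A\<close>: going down from the maximal elements, one
  sees that a kernel element of \<open>[G(F)]\<close> restricts on every fibre to a kernel element of \<open>[F(b)]\<close>
  (\<open>kernel_restricts_to_fibres\<close>), and \<open>u\<^sub>b\<close> is orthogonal to that.

  As \<open>M\<^sup>+\<close> is given by a definite description, its existence for every rational matrix has to be
  established as well (\<open>mp_inverse_exists\<close>).
\<close>

section \<open>Existence and uniqueness of the Moore--Penrose inverse\<close>

text \<open>
  Side conditions on dimensions, unlike the membership in \<open>carrier_mat\<close>, leave no unknown for
  the simplifier to guess.
\<close>

lemma mult_assoc_dim:
  fixes A :: "rat mat"
  assumes "dim_col A = dim_row B" and "dim_col B = dim_row C"
  shows "A * B * C = A * (B * C)"
  using assms by (intro assoc_mult_mat) (auto intro: carrier_matI)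

lemma transpose_mult_dim:
  fixes A :: "rat mat"
  assumes "dim_col A = dim_row B"
  shows "transpose_mat (A * B) = transpose_mat B * transpose_mat A"
  using assms by (intro transpose_mult) (auto intro: carrier_matI)

lemma index_mult_sum:
  fixes A :: "rat mat"
  assumes "i < dim_row A" and "j < dim_col B" and "dim_col A = dim_row B"
  shows "(A * B) $$ (i, j) = (\<Sum>k<dim_row B. A $$ (i, k) * B $$ (k, j))"
  using assms by (simp add: scalar_prod_def atLeast0LessThan)

text \<open>
  A linear map \<open>f\<close> has a linear right inverse \<open>g\<close> on its range, so \<open>f g f = f\<close>. To have all
  dimensions in one type, vectors are functions on all natural numbers here, and \<open>f\<close> reads only
  the coordinates below the number of columns and fills up its value with zeros.
\<close>

lemma inner_inverse_exists:
  fixes M :: "rat mat"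
  obtains G where "G \<in> carrier_mat (dim_col M) (dim_row M)" and "M * G * M = M"
proof -
  define s :: "rat \<Rightarrow> (nat \<Rightarrow> rat) \<Rightarrow> nat \<Rightarrow> rat" where "s c x = (\<lambda>i. c * x i)" for c x
  define f :: "(nat \<Rightarrow> rat) \<Rightarrow> nat \<Rightarrow> rat"
    where "f x = (\<lambda>i. if i < dim_row M then \<Sum>j<dim_col M. M $$ (i, j) * x j else 0)" for x
  define e :: "nat \<Rightarrow> nat \<Rightarrow> rat" where "e l = (\<lambda>i. if i = l then 1 else 0)" for l
  interpret V: vector_space s
    by unfold_locales (auto simp: s_def fun_eq_iff algebra_simps)
  interpret VV: vector_space_pair s s ..
  have lf: "Vector_Spaces.linear s s f"
    by unfold_locales
      (auto simp: s_def f_def fun_eq_iff algebra_simps sum.distrib sum_distrib_left)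
  obtain g where lg: "Vector_Spaces.linear s s g" and fg: "\<And>x. f (g (f x)) = f x"
    using VV.linear_exists_right_inverse_on[OF lf V.subspace_UNIV] by blast
  interpret g: Vector_Spaces.linear s s g by (rule lg)
  define G where "G = mat (dim_col M) (dim_row M) (\<lambda>(k, l). g (e l) k)"
  \<comment> \<open>\<open>f x\<close> is supported on the row indices, so there \<open>g\<close> is given by the matrix \<open>G\<close>\<close>
  have app: "(sum h S) i = (\<Sum>l\<in>S. h l i)" for h :: "nat \<Rightarrow> nat \<Rightarrow> rat" and S i
    by (induction S rule: infinite_finite_induct) auto
  have "(\<Sum>l<dim_row M. s (f x l) (e l)) i = (\<Sum>l<dim_row M. if l = i then f x l else 0)" for x i
    unfolding app by (intro sum.cong) (simp_all add: s_def e_def)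
  then have "f x = (\<Sum>l<dim_row M. s (f x l) (e l))" for x
    by (auto simp: fun_eq_iff f_def)
  then have "g (f x) = g (\<Sum>l<dim_row M. s (f x l) (e l))" for x
    by (rule arg_cong)
  moreover have "g (\<Sum>l<dim_row M. s (c l) (e l)) k = (\<Sum>l<dim_row M. c l * g (e l) k)" for c k
    unfolding g.sum g.scale app by (simp add: s_def)
  ultimately have gf: "g (f x) k = (\<Sum>l<dim_row M. f x l * g (e l) k)" for x k
    by simp
  have fe: "f (e j) i = M $$ (i, j)" if "i < dim_row M" "j < dim_col M" for i j
  proof -
    have "(\<Sum>k<dim_col M. M $$ (i, k) * e j k) = (\<Sum>k<dim_col M. if k = j then M $$ (i, k) else 0)"
      by (intro sum.cong) (simp_all add: e_def)
    then show ?thesis using that by (simp add: f_def)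
  qed
  have "(M * (G * M)) $$ (i, j) = M $$ (i, j)" if ij: "i < dim_row M" "j < dim_col M" for i j
  proof -
    have "(G * M) $$ (k, j) = g (f (e j)) k" if "k < dim_col M" for k
      using that ij by (subst index_mult_sum) (simp_all add: G_def gf fe mult.commute)
    then have "(M * (G * M)) $$ (i, j) = f (g (f (e j))) i"
      using ij by (subst index_mult_sum) (simp_all add: G_def f_def del: index_mult_mat(1))
    then show ?thesis using ij by (simp add: fg fe)
  qed
  then have "M * (G * M) = M" by (intro eq_matI) (auto simp: G_def)
  then show thesis
    by (intro that[of G]) (auto simp: mult_assoc_dim G_def)
qed

text \<open>
  For \<open>D = M (Y - Z)\<close> the hypothesis gives \<open>M\<^sup>T D = 0\<close>, hence \<open>D\<^sup>T D = 0\<close>. The diagonal of \<open>D\<^sup>T D\<close> consists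
  of sums of squares of rationals, so \<open>D = 0\<close>.
\<close>

lemma transpose_times_cancel:
  fixes M :: "rat mat"
  assumes "dim_row Y = dim_col M" "dim_row Z = dim_col M" "dim_col Y = dim_col Z"
    and eq: "transpose_mat M * (M * Y) = transpose_mat M * (M * Z)"
  shows "M * Y = M * Z"
proof -
  define D where "D = M * (Y - Z)"
  have D: "D = M * Y - M * Z"
    unfolding D_def using assms by (intro mult_minus_distrib_mat) (auto intro: carrier_matI)
  have [simp]: "dim_row D = dim_row M" "dim_col D = dim_col Z" by (auto simp: D)
  have "transpose_mat M * D = transpose_mat M * (M * Y) - transpose_mat M * (M * Z)"
    unfolding D using assms by (intro mult_minus_distrib_mat) (auto intro: carrier_matI)
  then have *: "transpose_mat M * D = 0\<^sub>m (dim_col M) (dim_col Z)"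
    using eq by (simp add: minus_r_inv_mat[OF carrier_matI])
  have "transpose_mat D * D = transpose_mat (Y - Z) * (transpose_mat M * D)"
    unfolding D_def using assms by (simp add: transpose_mult_dim mult_assoc_dim)
  also have "\<dots> = 0\<^sub>m (dim_col Z) (dim_col Z)"
    unfolding * by (rule right_mult_zero_mat) (use assms in \<open>auto intro: carrier_matI\<close>)
  finally have DD: "transpose_mat D * D = 0\<^sub>m (dim_col Z) (dim_col Z)" .
  have "D $$ (i, j) = 0" if "i < dim_row M" "j < dim_col Z" for i j
  proof -
    have "(\<Sum>k<dim_row M. D $$ (k, j) * D $$ (k, j)) = (transpose_mat D * D) $$ (j, j)"
      using that by (subst index_mult_sum) auto
    also have "\<dots> = 0" using that DD by simp
    finally show ?thesis
      using that by (auto simp: sum_nonneg_eq_0_iff)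
  qed
  then have "(M * Y) $$ (i, j) = (M * Z) $$ (i, j)" if "i < dim_row M" "j < dim_col Z" for i j
    using that assms unfolding D by (fastforce simp del: index_mult_mat(1))
  then show ?thesis using assms by (intro eq_matI) (auto simp del: index_mult_mat(1))
qed

text \<open>
  With an inner inverse \<open>H\<close> of \<open>A = M\<^sup>T M\<close> take \<open>G = H M\<^sup>T\<close>. Cancelling \<open>M\<^sup>T\<close> in \<open>A H A = A\<close> gives
  \<open>M G M = M\<close>. As \<open>A\<close> is symmetric, \<open>H\<^sup>T\<close> is also an inner inverse of \<open>A\<close>, so \<open>E = M G\<close> satisfies
  \<open>E\<^sup>T M = M\<close>, hence \<open>E\<^sup>T E = E\<close>, which makes \<open>E\<close> symmetric.
\<close>

lemma inner_inverse_symmetric_exists: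
  fixes M :: "rat mat"
  obtains G where "G \<in> carrier_mat (dim_col M) (dim_row M)" and "M * G * M = M"
    and "transpose_mat (M * G) = M * G"
proof -
  define A where "A = transpose_mat M * M"
  have A [simp]: "dim_row A = dim_col M" "dim_col A = dim_col M" "transpose_mat A = A"
    by (simp_all add: A_def transpose_mult_dim)
  obtain H where "H \<in> carrier_mat (dim_col A) (dim_row A)" and AHA: "A * H * A = A"
    by (rule inner_inverse_exists)
  then have H [simp]: "dim_row H = dim_col M" "dim_col H = dim_col M" by auto
  have cancel: "M * (K * A) = M" if "A * (K * A) = A" "dim_row K = dim_col M" "dim_col K = dim_col M" for K
  proof -
    have "M * (K * A) = M * 1\<^sub>m (dim_col M)"
      by (rule transpose_times_cancel) (use that in \<open>simp_all add: mult_assoc_dim[symmetric] A_def[symmetric]\<close>)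
    then show ?thesis by simp
  qed
  have AHA': "A * (H * A) = A" using AHA by (simp add: mult_assoc_dim)
  have "transpose_mat (A * (H * A)) = A * (transpose_mat H * A)"
    by (simp add: transpose_mult_dim mult_assoc_dim)
  then have AHTA: "A * (transpose_mat H * A) = A" by (simp add: AHA')
  define G where "G = H * transpose_mat M"
  define E where "E = M * G"
  have [simp]: "dim_row G = dim_col M" "dim_col G = dim_row M" by (simp_all add: G_def)
  have ET: "transpose_mat E = M * (transpose_mat H * transpose_mat M)"
    by (simp add: E_def G_def transpose_mult_dim mult_assoc_dim)
  have EM: "E * M = M"
    using cancel[OF AHA'] by (simp add: E_def G_def A_def mult_assoc_dim)
  have ETM: "transpose_mat E * M = M"
    using cancel[OF AHTA] by (simp add: ET A_def mult_assoc_dim)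
  have "transpose_mat E * E = (transpose_mat E * M) * G"
    by (simp add: E_def mult_assoc_dim)
  also have "\<dots> = E" unfolding ETM by (simp add: E_def)
  finally have ETE: "transpose_mat E * E = E" .
  have "transpose_mat (transpose_mat E * E) = transpose_mat E * E"
    by (simp add: transpose_mult_dim)
  then have "transpose_mat E = E" by (simp add: ETE)
  then show thesis
    using EM by (intro that[of G]) (auto simp: E_def intro: carrier_matI)
qed

text \<open>
  Besides an inner inverse \<open>G\<close> with \<open>M G\<close> symmetric there is, by passing to the transpose, an
  inner inverse \<open>L\<close> with \<open>L M\<close> symmetric. Then \<open>N = L M G\<close> has \<open>M N = M G\<close> and \<open>N M = L M\<close>.
\<close>

lemma mp_inverse_exists: "\<exists>N. is_mp_inverse M N"
proof -
  obtain G where "G \<in> carrier_mat (dim_col M) (dim_row M)" and MGM: "M * G * M = M"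
    and MG: "transpose_mat (M * G) = M * G"
    by (rule inner_inverse_symmetric_exists)
  then have [simp]: "dim_row G = dim_col M" "dim_col G = dim_row M" by auto
  obtain K where "K \<in> carrier_mat (dim_col (transpose_mat M)) (dim_row (transpose_mat M))"
    and MKM: "transpose_mat M * K * transpose_mat M = transpose_mat M"
    and MK: "transpose_mat (transpose_mat M * K) = transpose_mat M * K"
    by (rule inner_inverse_symmetric_exists)
  then have [simp]: "dim_row K = dim_row M" "dim_col K = dim_col M" by auto
  define L where "L = transpose_mat K"
  have [simp]: "dim_row L = dim_col M" "dim_col L = dim_row M" by (simp_all add: L_def)
  have K: "K = transpose_mat L" by (simp add: L_def)
  have LM: "transpose_mat (L * M) = L * M"
    using MK by (simp add: K transpose_mult_dim)
  have "transpose_mat (transpose_mat M * K * transpose_mat M) = M"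
    unfolding MKM by simp
  then have MLM: "M * (L * M) = M"
    by (simp add: K transpose_mult_dim mult_assoc_dim)
  have MGM': "M * (G * M) = M" using MGM by (simp add: mult_assoc_dim)
  define N where "N = L * M * G"
  have [simp]: "dim_row N = dim_col M" "dim_col N = dim_row M" by (simp_all add: N_def)
  have MN: "M * N = M * G"
  proof -
    have "M * N = M * (L * M) * G" by (simp add: N_def mult_assoc_dim)
    then show ?thesis by (simp add: MLM)
  qed
  have NM: "N * M = L * M" by (simp add: N_def mult_assoc_dim MGM')
  have "N * M * N = L * (M * N)" by (simp add: NM mult_assoc_dim)
  also have "\<dots> = N" unfolding MN by (simp add: N_def mult_assoc_dim)
  finally have "N * M * N = N" .
  moreover have "M * N * M = M" by (simp add: MN MGM)
  ultimately have "is_mp_inverse M N"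
    by (auto simp: is_mp_inverse_def MN NM MG LM intro: carrier_matI)
  then show ?thesis ..
qed

text \<open>
  Both \<open>M N\<close> and \<open>M N'\<close> are the orthogonal projection onto the column space of \<open>M\<close>, both \<open>N M\<close> and
  \<open>N' M\<close> the one onto its row space.
\<close>

lemma mp_inverse_mult_eq:
  assumes "is_mp_inverse M N" and "is_mp_inverse M N'"
  shows "M * N = M * N'" and "N * M = N' * M"
proof -
  have [simp]: "dim_row N = dim_col M" "dim_col N = dim_row M"
    "dim_row N' = dim_col M" "dim_col N' = dim_row M"
    using assms by (auto simp: is_mp_inverse_def)
  have M: "M * N * M = M" "M * N' * M = M"
    and sym: "transpose_mat (M * N) = M * N" "transpose_mat (M * N') = M * N'"
      "transpose_mat (N * M) = N * M" "transpose_mat (N' * M) = N' * M"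
    using assms by (auto simp: is_mp_inverse_def)
  have "M * N = transpose_mat (M * N' * M * N)" by (simp only: M sym)
  also have "\<dots> = transpose_mat ((M * N') * (M * N))" by (simp add: mult_assoc_dim)
  also have "\<dots> = (M * N) * (M * N')"
    by (subst transpose_mult_dim) (simp_all only: sym index_mult_mat, simp)
  also have "\<dots> = M * N * M * N'" by (simp add: mult_assoc_dim)
  finally show "M * N = M * N'" by (simp only: M)
  have "N * M = transpose_mat (N * (M * N' * M))" by (simp only: M sym)
  also have "\<dots> = transpose_mat ((N * M) * (N' * M))" by (simp add: mult_assoc_dim)
  also have "\<dots> = (N' * M) * (N * M)"
    by (subst transpose_mult_dim) (simp_all only: sym index_mult_mat, simp)
  also have "\<dots> = N' * (M * N * M)" by (simp add: mult_assoc_dim)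
  finally show "N * M = N' * M" by (simp only: M)
qed

lemma mp_inverse_unique:
  assumes "is_mp_inverse M N" and "is_mp_inverse M N'"
  shows "N = N'"
proof -
  have [simp]: "dim_row N = dim_col M" "dim_col N = dim_row M"
    "dim_row N' = dim_col M" "dim_col N' = dim_row M"
    using assms by (auto simp: is_mp_inverse_def)
  have "N = N * M * N" using assms by (simp add: is_mp_inverse_def)
  also have "\<dots> = N * (M * N')" by (simp add: mult_assoc_dim mp_inverse_mult_eq(1)[OF assms])
  also have "\<dots> = N' * M * N'"
    by (simp add: mult_assoc_dim[symmetric] mp_inverse_mult_eq(2)[OF assms])
  also have "\<dots> = N'" using assms by (simp add: is_mp_inverse_def)
  finally show ?thesis .
qed

lemma is_mp_inverse_mp_inverse: "is_mp_inverse M (mp_inverse M)"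
  unfolding mp_inverse_def
  using mp_inverse_exists[of M] mp_inverse_unique[of M] by (metis theI)

section \<open>The Euler characteristic as the total weight of the least weighting\<close>

text \<open>
  The matrix \<open>[C]\<close> applied to a column that is indexed by the objects themselves, which frees the
  later arguments from the choice of an enumeration.
\<close>

definition hom_apply :: "('o, 'm) cat \<Rightarrow> ('o \<Rightarrow> rat) \<Rightarrow> 'o \<Rightarrow> rat" where
  "hom_apply C v x = (\<Sum>y\<in>Obj C. of_nat (card (Hom C x y)) * v y)"

text \<open>
  The weightings form a translate of the kernel of \<open>[C]\<close>; the one that is orthogonal to the kernel
  is the weighting of least Euclidean norm.
\<close>

definition least_weighting :: "('o, 'm) cat \<Rightarrow> ('o \<Rightarrow> rat) \<Rightarrow> bool" where
  "least_weighting C v \<longleftrightarrow> (\<forall>x\<in>Obj C. hom_apply C v x = 1) \<and>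
     (\<forall>k. (\<forall>x\<in>Obj C. hom_apply C k x = 0) \<longrightarrow> (\<Sum>y\<in>Obj C. v y * k y) = 0)"

text \<open>The difference of two least weightings lies in the kernel and is orthogonal to itself.\<close>

lemma least_weighting_unique:
  assumes "finite (Obj C)" and "least_weighting C u" and "least_weighting C v" and "x \<in> Obj C"
  shows "u x = v x"
proof -
  define k where "k y = u y - v y" for y
  have "hom_apply C k x = 0" if "x \<in> Obj C" for x
  proof -
    have "hom_apply C k x = hom_apply C u x - hom_apply C v x"
      by (simp add: hom_apply_def k_def algebra_simps sum_subtractf)
    then show ?thesis using assms that by (simp add: least_weighting_def)
  qed
  then have "(\<Sum>y\<in>Obj C. u y * k y) = 0" "(\<Sum>y\<in>Obj C. v y * k y) = 0"
    using assms by (auto simp: least_weighting_def)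
  then have "(\<Sum>y\<in>Obj C. k y * k y) = 0"
    by (simp add: k_def left_diff_distrib sum_subtractf)
  then have "k x = 0"
    using assms(1,4) by (simp add: sum_nonneg_eq_0_iff)
  then show ?thesis by (simp add: k_def)
qed

lemma sum_enumerates:
  assumes "enumerates xs S"
  shows "(\<Sum>y\<in>S. g y) = (\<Sum>j<length xs. g (xs ! j))"
  using assms by (intro sum.reindex_bij_betw[symmetric] bij_betw_nth) (auto simp: enumerates_def)

lemma hom_matrix_mult:
  assumes "enumerates xs (Obj C)" and "w \<in> carrier_mat (length xs) 1"
    and "\<And>j. j < length xs \<Longrightarrow> w $$ (j, 0) = v (xs ! j)"
    and "i < length xs"
  shows "(hom_matrix C xs * w) $$ (i, 0) = hom_apply C v (xs ! i)"
proof -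
  have "dim_row w = length xs" "dim_col w = 1" using assms(2) by auto
  then have "(hom_matrix C xs * w) $$ (i, 0)
      = (\<Sum>j<length xs. hom_matrix C xs $$ (i, j) * w $$ (j, 0))"
    using assms(4) by (subst index_mult_sum) (simp_all add: hom_matrix_def)
  also have "\<dots> = (\<Sum>j<length xs. of_nat (card (Hom C (xs ! i) (xs ! j))) * v (xs ! j))"
    using assms(4) by (intro sum.cong) (simp_all add: hom_matrix_def assms(3))
  finally show ?thesis by (simp add: hom_apply_def sum_enumerates[OF assms(1)])
qed

lemma enumerates_nth:
  assumes "enumerates xs S" and "i < length xs"
  shows "xs ! i \<in> S"
  using assms nth_mem unfolding enumerates_def by blast

lemma weighting_hom_matrix:
  assumes "enumerates xs (Obj C)" and "\<And>x. x \<in> Obj C \<Longrightarrow> hom_apply C v x = 1"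
  shows "weighting (hom_matrix C xs) (mat (length xs) 1 (\<lambda>(i, j). v (xs ! i)))"
  unfolding weighting_def
proof (intro conjI eq_matI)
  fix i j
  assume "i < dim_row (ones (dim_row (hom_matrix C xs)))"
    "j < dim_col (ones (dim_row (hom_matrix C xs)))"
  then have ij: "i < length xs" "j = 0" by (simp_all add: hom_matrix_def ones_def)
  have "(hom_matrix C xs * mat (length xs) 1 (\<lambda>(i, j). v (xs ! i))) $$ (i, 0)
      = hom_apply C v (xs ! i)"
    by (rule hom_matrix_mult[OF assms(1)]) (simp_all add: ij)
  also have "\<dots> = 1" by (rule assms(2)[OF enumerates_nth[OF assms(1) ij(1)]])
  finally show "(hom_matrix C xs * mat (length xs) 1 (\<lambda>(i, j). v (xs ! i))) $$ (i, j)
      = ones (dim_row (hom_matrix C xs)) $$ (i, j)"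
    using ij by (simp add: hom_matrix_def ones_def del: index_mult_mat(1))
qed (simp_all add: hom_matrix_def ones_def)

text \<open>The matrix \<open>M M\<^sup>+\<close> fixes the columns of \<open>M\<close>, hence also \<open>M w\<close>, which is the column of ones.\<close>

lemma weighting_mp_inverse_ones:
  assumes "weighting M w"
  shows "M * (mp_inverse M * ones (dim_row M)) = ones (dim_row M)"
proof -
  have mp: "is_mp_inverse M (mp_inverse M)" by (rule is_mp_inverse_mp_inverse)
  then have [simp]: "dim_row (mp_inverse M) = dim_col M" "dim_col (mp_inverse M) = dim_row M"
    by (auto simp: is_mp_inverse_def)
  have w: "w \<in> carrier_mat (dim_col M) 1" and Mw: "M * w = ones (dim_row M)"
    using assms by (auto simp: weighting_def)
  have "M * (mp_inverse M * ones (dim_row M)) = M * mp_inverse M * M * w"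
    using w by (simp add: Mw[symmetric] mult_assoc_dim)
  then show ?thesis using mp by (simp add: is_mp_inverse_def Mw)
qed

text \<open>
  The identity \<open>N = N M N = (N M)\<^sup>T N\<close> for \<open>N = M\<^sup>+\<close> puts every column of \<open>M\<^sup>+\<close> into the row space
  of \<open>M\<close>, and the row space is orthogonal to the kernel.
\<close>

lemma mp_inverse_mult_orthogonal_kernel:
  fixes M :: "rat mat"
  assumes c: "c \<in> carrier_mat (dim_row M) 1"
    and k: "k \<in> carrier_mat (dim_col M) 1" and Mk: "M * k = 0\<^sub>m (dim_row M) 1"
  shows "transpose_mat (mp_inverse M * c) * k = 0\<^sub>m 1 1"
proof -
  define N where "N = mp_inverse M"
  define u where "u = N * c"
  have mp: "is_mp_inverse M N"
    unfolding N_def by (rule is_mp_inverse_mp_inverse)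
  then have [simp]: "dim_row N = dim_col M" "dim_col N = dim_row M"
    by (auto simp: is_mp_inverse_def)
  have NMN: "N * M * N = N" and sym: "transpose_mat (N * M) = N * M"
    using mp by (auto simp: is_mp_inverse_def)
  have u: "u = N * M * u"
    using c by (simp add: u_def mult_assoc_dim[symmetric] NMN)
  have [simp]: "dim_row u = dim_col M" "dim_col u = 1" using c by (simp_all add: u_def)
  have "transpose_mat u = transpose_mat u * (N * M)"
    by (subst (1) u) (simp add: transpose_mult_dim[of "N * M"] sym)
  then have "transpose_mat u * k = transpose_mat u * (N * M) * k" by simp
  also have "\<dots> = (transpose_mat u * N) * (M * k)"
    using k by (simp add: mult_assoc_dim)
  also have "\<dots> = 0\<^sub>m 1 1"
    unfolding Mk by (rule right_mult_zero_mat) (auto intro: carrier_matI)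
  finally show ?thesis by (simp add: u_def N_def)
qed

text \<open>
  As soon as some weighting exists, the column \<open>[C]\<^sup>+ 1\<close> is the least weighting, read along the
  enumeration.
\<close>

lemma least_weighting_mp_inverse:
  assumes xs: "enumerates xs (Obj C)" and w: "weighting (hom_matrix C xs) w"
  obtains v where "least_weighting C v"
    and "\<And>i. i < length xs \<Longrightarrow> v (xs ! i) = (mp_inverse (hom_matrix C xs) * ones (length xs)) $$ (i, 0)"
proof -
  define M where "M = hom_matrix C xs"
  have [simp]: "dim_row M = length xs" "dim_col M = length xs" by (simp_all add: M_def hom_matrix_def)
  define u where "u = mp_inverse M * ones (length xs)"
  have "mp_inverse M \<in> carrier_mat (length xs) (length xs)"
    using is_mp_inverse_mp_inverse[of M] by (simp add: is_mp_inverse_def)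
  then have u: "u \<in> carrier_mat (length xs) 1" by (auto simp: u_def ones_def)
  define v where "v x = u $$ (THE i. i < length xs \<and> xs ! i = x, 0)" for x
  have v: "v (xs ! i) = u $$ (i, 0)" if "i < length xs" for i
  proof -
    have "(THE j. j < length xs \<and> xs ! j = xs ! i) = i"
      using that xs by (intro the_equality) (auto simp: enumerates_def nth_eq_iff_index_eq)
    then show ?thesis by (simp add: v_def)
  qed
  have nth: "\<exists>i<length xs. x = xs ! i" if "x \<in> Obj C" for x
    using that xs by (metis enumerates_def in_set_conv_nth)
  have Mu: "M * u = ones (length xs)"
    using weighting_mp_inverse_ones[OF w] by (simp add: u_def M_def[symmetric])
  have orth: "transpose_mat u * k = 0\<^sub>m 1 1"
    if "k \<in> carrier_mat (length xs) 1" "M * k = 0\<^sub>m (length xs) 1" for k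
    unfolding u_def by (rule mp_inverse_mult_orthogonal_kernel) (use that in \<open>auto simp: ones_def\<close>)
  have "hom_apply C v (xs ! i) = 1" if "i < length xs" for i
    using hom_matrix_mult[OF xs u v[symmetric] that] Mu that by (simp add: M_def[symmetric] ones_def)
  moreover have "(\<Sum>y\<in>Obj C. v y * k y) = 0" if k: "\<forall>x\<in>Obj C. hom_apply C k x = 0" for k
  proof -
    define K where "K = mat (length xs) 1 (\<lambda>(i, j). k (xs ! i))"
    have K: "K \<in> carrier_mat (length xs) 1" by (simp add: K_def)
    have "M * K = 0\<^sub>m (length xs) 1"
    proof (rule eq_matI)
      fix i j assume "i < dim_row (0\<^sub>m (length xs) 1)" "j < dim_col (0\<^sub>m (length xs) 1)"
      then have ij: "i < length xs" "j = 0" by auto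
      moreover have "xs ! i \<in> Obj C" by (rule enumerates_nth[OF xs ij(1)])
      ultimately show "(M * K) $$ (i, j) = 0\<^sub>m (length xs) 1 $$ (i, j)"
        using hom_matrix_mult[OF xs K, of k i] k by (simp add: K_def M_def)
    qed (use K in auto)
    then have "transpose_mat u * K = 0\<^sub>m 1 1" by (rule orth[OF K])
    moreover have "(transpose_mat u * K) $$ (0, 0) = (\<Sum>j<length xs. v (xs ! j) * k (xs ! j))"
      using u by (subst index_mult_sum) (auto simp: K_def v)
    ultimately show ?thesis by (simp add: sum_enumerates[OF xs])
  qed
  ultimately have "least_weighting C v"
    unfolding least_weighting_def using nth by blast
  then show thesis by (rule that) (simp add: v u_def M_def)
qed

lemma enumerates_obj_list:
  assumes "finite (Obj C)"
  shows "enumerates (obj_list C) (Obj C)"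
proof -
  have "\<exists>xs. enumerates xs (Obj C)"
    using finite_distinct_list[OF assms] by (auto simp: enumerates_def)
  then show ?thesis unfolding obj_list_def by (rule someI_ex)
qed

text \<open>
  The Euler characteristic is the sum of the entries of \<open>[C]\<^sup>+ 1\<close>, and this column is the least
  weighting. So it can be computed from any function known to be a least weighting.
\<close>

lemma euler_char_eq_sum:
  assumes fin: "finite (Obj C)" and v: "least_weighting C v"
  shows "euler_char C = (\<Sum>x\<in>Obj C. v x)"
proof -
  define xs where "xs = obj_list C"
  define u where "u = mp_inverse (hom_matrix C xs) * ones (length xs)"
  have xs: "enumerates xs (Obj C)" unfolding xs_def by (rule enumerates_obj_list[OF fin])
  then have n: "card (Obj C) = length xs" by (metis distinct_card enumerates_def)
  have "weighting (hom_matrix C xs) (mat (length xs) 1 (\<lambda>(i, j). v (xs ! i)))"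
    using v by (intro weighting_hom_matrix[OF xs]) (simp add: least_weighting_def)
  then obtain v' where v': "least_weighting C v'"
    and v'u: "\<And>i. i < length xs \<Longrightarrow> v' (xs ! i) = u $$ (i, 0)"
    unfolding u_def by (rule least_weighting_mp_inverse[OF xs]) blast
  have mp: "mp_inverse (hom_matrix C xs) \<in> carrier_mat (length xs) (length xs)"
    using is_mp_inverse_mp_inverse[of "hom_matrix C xs"]
    by (simp add: is_mp_inverse_def hom_matrix_def)
  then have "euler_char C = (transpose_mat (ones (length xs)) * u) $$ (0, 0)"
    by (simp add: euler_char_def n u_def xs_def[symmetric] mult_assoc_dim ones_def)
  also have "\<dots> = (\<Sum>j<length xs. u $$ (j, 0))"
    using mp by (subst index_mult_sum) (auto simp: u_def ones_def)
  also have "\<dots> = (\<Sum>x\<in>Obj C. v' x)"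
    by (simp add: sum_enumerates[OF xs] v'u)
  also have "\<dots> = (\<Sum>x\<in>Obj C. v x)"
    by (intro sum.cong refl least_weighting_unique[OF fin v' v])
  finally show ?thesis .
qed

section \<open>Hom-matrices of categories and of finite posets\<close>

text \<open>Composition with an isomorphism and with its inverse are mutually inverse bijections.\<close>

lemma card_Hom_isomorphic_source:
  assumes "category C" and iso: "isomorphism C x x' t"
    and x: "x \<in> Obj C" and x': "x' \<in> Obj C" and y: "y \<in> Obj C"
  shows "card (Hom C x y) = card (Hom C x' y)"
proof -
  interpret category C by (rule assms(1))
  obtain s where t: "t \<in> Hom C x x'" and s: "s \<in> Hom C x' x"
    and st: "cat_comp C x x' x s t = Idt C x" and ts: "cat_comp C x' x x' t s = Idt C x'"
    using iso by (auto simp: isomorphism_def iso_pair_def)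
  have "bij_betw (\<lambda>g. cat_comp C x' x y g s) (Hom C x y) (Hom C x' y)"
  proof (rule bij_betw_byWitness[where f' = "\<lambda>g. cat_comp C x x' y g t"])
    show "\<forall>g\<in>Hom C x y. cat_comp C x x' y (cat_comp C x' x y g s) t = g"
      using comp_assoc[OF x x' x y t s] comp_id_right[OF x y] st by simp
    show "\<forall>g\<in>Hom C x' y. cat_comp C x' x y (cat_comp C x x' y g t) s = g"
      using comp_assoc[OF x' x x' y s t] comp_id_right[OF x' y] ts by simp
  qed (use comp_in_hom x x' y s t in auto)
  then show ?thesis by (rule bij_betw_same_card)
qed

lemma hom_apply_isomorphic:
  assumes "category C" and "isomorphism C x x' t" and "x \<in> Obj C" and "x' \<in> Obj C"
  shows "hom_apply C v x = hom_apply C v x'"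
  unfolding hom_apply_def
  by (intro sum.cong refl) (simp add: card_Hom_isomorphic_source[OF assms])

text \<open>
  Oriented so that a well-founded recursion or induction along this relation runs from the maximal
  elements of the poset downwards.
\<close>

definition strictly_above :: "'a set \<Rightarrow> ('a \<times> 'a) set \<Rightarrow> ('a \<times> 'a) set" where
  "strictly_above P r = {(b, a). a \<in> P \<and> b \<in> P \<and> (a, b) \<in> r \<and> a \<noteq> b}"

text \<open>Going up strictly, the number of elements that lie above decreases.\<close>

lemma wf_strictly_above:
  assumes "finite P" and "partial_order_on P r"
  shows "wf (strictly_above P r)"
proof (rule wf_subset)
  show "strictly_above P r \<subseteq> measure (\<lambda>a. card {c \<in> P. (a, c) \<in> r})"
  proof clarify
    fix b a assume "(b, a) \<in> strictly_above P r"
    then have ab: "a \<in> P" "b \<in> P" "(a, b) \<in> r" "a \<noteq> b" by (auto simp: strictly_above_def)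
    have tr: "trans r" and an: "antisym r" and re: "refl_on P r"
      using assms(2) by (auto simp: partial_order_on_def preorder_on_def)
    have "(a, a) \<in> r" using re ab by (auto simp: refl_on_def)
    moreover have "(b, a) \<notin> r" using an ab by (auto dest: antisymD)
    moreover have "{c \<in> P. (b, c) \<in> r} \<subseteq> {c \<in> P. (a, c) \<in> r}"
      using tr ab by (auto dest: transD)
    ultimately have "{c \<in> P. (b, c) \<in> r} \<subset> {c \<in> P. (a, c) \<in> r}" using ab by blast
    then show "(b, a) \<in> measure (\<lambda>a. card {c \<in> P. (a, c) \<in> r})"
      using assms(1) by (auto intro: psubset_card_mono)
  qed
qed simp

lemma sum_up_set:
  assumes "finite P" and "partial_order_on P r" and "a \<in> P"
  shows "(\<Sum>b | b \<in> P \<and> (a, b) \<in> r. g b) =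
    (g a + (\<Sum>b | (b, a) \<in> strictly_above P r. g b) :: rat)"
proof -
  have "(a, a) \<in> r" using assms by (auto simp: partial_order_on_def preorder_on_def refl_on_def)
  then have "{b. b \<in> P \<and> (a, b) \<in> r} = insert a {b. (b, a) \<in> strictly_above P r}"
    using assms(3) by (auto simp: strictly_above_def)
  moreover have "finite {b. (b, a) \<in> strictly_above P r}"
    by (rule finite_subset[OF _ assms(1)]) (auto simp: strictly_above_def)
  moreover have "a \<notin> {b. (b, a) \<in> strictly_above P r}" by (simp add: strictly_above_def)
  ultimately show ?thesis by simp
qed

text \<open>
  In a suitable order of the elements the matrix of a poset is unitriangular, so the weighting
  equations can be solved from the maximal elements downwards.
\<close>

lemma poset_weighting_exists:
  assumes "finite P" and "partial_order_on P r"
  obtains w :: "'a \<Rightarrow> rat" where "\<And>a. a \<in> P \<Longrightarrow> (\<Sum>b | b \<in> P \<and> (a, b) \<in> r. w b) = 1"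
proof
  define step :: "('a \<Rightarrow> rat) \<Rightarrow> 'a \<Rightarrow> rat"
    where "step w a = 1 - (\<Sum>b | (b, a) \<in> strictly_above P r. w b)" for w a
  define w where "w = wfrec (strictly_above P r) step"
  have w_eq: "w a = 1 - (\<Sum>b | (b, a) \<in> strictly_above P r. w b)" for a
    by (subst def_wfrec[OF eq_reflection[OF w_def] wf_strictly_above[OF assms]])
      (simp add: step_def cut_apply)
  show "(\<Sum>b | b \<in> P \<and> (a, b) \<in> r. w b) = 1" if "a \<in> P" for a
    using sum_up_set[OF assms that, of w] w_eq[of a] by simp
qed

lemma hom_apply_poset_category:
  assumes "finite P"
  shows "hom_apply (poset_category P r) v a = (\<Sum>b | b \<in> P \<and> (a, b) \<in> r. v b)"
proof -
  have "card {e. e = (a, b) \<and> (a, b) \<in> r} = (if (a, b) \<in> r then 1 else 0)" for b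
    by simp
  then have "hom_apply (poset_category P r) v a = (\<Sum>b\<in>P. if (a, b) \<in> r then v b else 0)"
    unfolding hom_apply_def poset_category_def by (intro sum.cong) simp_all
  also have "\<dots> = (\<Sum>b | b \<in> P \<and> (a, b) \<in> r. v b)"
    using assms by (rule sum.inter_filter[symmetric])
  finally show ?thesis .
qed

section \<open>The Grothendieck construction over a finite poset\<close>

lemma Obj_grothendieck_poset:
  "Obj (grothendieck (poset_category P r) F) = (SIGMA a:P. Obj (cat_at F a))"
  by (auto simp: grothendieck_def poset_category_def)

text \<open>
  A morphism from \<open>(a, x)\<close> to \<open>(b, y)\<close> exists only if \<open>a \<le> b\<close>, and then it is a morphism in \<open>F(b)\<close>
  from the image of \<open>x\<close> to \<open>y\<close>. So the block of \<open>[G(F)]\<close> at \<open>(a, b)\<close> consists of rows of \<open>[F(b)]\<close>.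
\<close>

lemma hom_apply_grothendieck:
  assumes "finite P" and "\<And>b. b \<in> P \<Longrightarrow> finite (Obj (cat_at F b))"
  shows "hom_apply (grothendieck (poset_category P r) F) v (a, x) =
    (\<Sum>b | b \<in> P \<and> (a, b) \<in> r.
       hom_apply (cat_at F b) (\<lambda>y. v (b, y)) (on_obj (func_at F a b (a, b)) x))"
proof -
  let ?G = "grothendieck (poset_category P r) F"
  let ?x = "\<lambda>b. on_obj (func_at F a b (a, b)) x"
  have card: "card (Hom ?G (a, x) (b, y)) =
      (if (a, b) \<in> r then card (Hom (cat_at F b) (?x b) y) else 0)" for b y
  proof -
    have "Hom ?G (a, x) (b, y) =
        (if (a, b) \<in> r then Pair (a, b) ` Hom (cat_at F b) (?x b) y else {})"
      by (auto simp: grothendieck_def poset_category_def)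
    then show ?thesis by (simp add: card_image inj_on_def)
  qed
  have "hom_apply ?G v (a, x) =
      (\<Sum>b\<in>P. \<Sum>y\<in>Obj (cat_at F b). of_nat (card (Hom ?G (a, x) (b, y))) * v (b, y))"
    unfolding hom_apply_def Obj_grothendieck_poset
    using assms by (subst sum.Sigma) (auto intro!: sum.cong)
  also have "\<dots> = (\<Sum>b\<in>P. if (a, b) \<in> r
      then hom_apply (cat_at F b) (\<lambda>y. v (b, y)) (?x b) else 0)"
    by (intro sum.cong) (simp_all add: card hom_apply_def)
  also have "\<dots> = (\<Sum>b | b \<in> P \<and> (a, b) \<in> r.
      hom_apply (cat_at F b) (\<lambda>y. v (b, y)) (?x b))"
    using assms(1) by (rule sum.inter_filter[symmetric])
  finally show ?thesis .
qed

locale finite_poset_pseudofunctor =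
  fixes P :: "'a set" and r :: "('a \<times> 'a) set"
    and F :: "('a, 'a \<times> 'a, 'o, 'm) pseudofunc"
  assumes finite_P: "finite P" and po: "partial_order_on P r"
    and psf: "pseudofunctor (poset_category P r) F"
    and finite_Obj: "\<And>a. a \<in> P \<Longrightarrow> finite (Obj (cat_at F a))"
begin

abbreviation G where "G \<equiv> grothendieck (poset_category P r) F"

lemma transport_in_Obj:
  assumes "a \<in> P" and "b \<in> P" and "(a, b) \<in> r" and "x \<in> Obj (cat_at F a)"
  shows "on_obj (func_at F a b (a, b)) x \<in> Obj (cat_at F b)"
proof -
  interpret pseudofunctor "poset_category P r" F by (rule psf)
  interpret cat_functor "cat_at F a" "cat_at F b" "func_at F a b (a, b)"
    by (rule functor_at) (use assms in \<open>auto simp: poset_category_def\<close>)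
  show ?thesis by (rule obj_in[OF assms(4)])
qed

text \<open>
  A pseudofunctor need not send an identity to an identity functor, but its unitor is an
  isomorphism from the image of \<open>x\<close> to \<open>x\<close>.
\<close>

lemma hom_apply_transport_self:
  assumes "a \<in> P" and "x \<in> Obj (cat_at F a)"
  shows "hom_apply (cat_at F a) v (on_obj (func_at F a a (a, a)) x) = hom_apply (cat_at F a) v x"
proof -
  interpret pseudofunctor "poset_category P r" F by (rule psf)
  have a: "a \<in> Obj (poset_category P r)" "Idt (poset_category P r) a = (a, a)"
    using assms by (auto simp: poset_category_def)
  interpret natural_isomorphism "cat_at F a" "cat_at F a" "func_at F a a (a, a)" id_func "unitor F a"
    using unitor_natural_iso[OF a(1)] by (simp add: a(2))
  have "isomorphism (cat_at F a) (on_obj (func_at F a a (a, a)) x) x (unitor F a x)"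
    using component_iso[OF assms(2)] by (simp add: id_func_def)
  then show ?thesis
    by (rule hom_apply_isomorphic[OF category_at[OF a(1)]]) (use F.obj_in assms in auto)
qed

text \<open>
  Row \<open>(a, x)\<close> of \<open>[G(F)]\<close> pairs the components \<open>k\<^sub>b\<close> for \<open>b \<ge> a\<close> with rows of \<open>[F(b)]\<close>. If \<open>k\<^sub>b\<close> lies in
  the kernel of \<open>[F(b)]\<close> for all \<open>b > a\<close>, only the term of \<open>a\<close> itself survives, and it is the row
  of \<open>[F(a)]\<close> at an object isomorphic to \<open>x\<close>.
\<close>

lemma kernel_restricts_to_fibres:
  assumes k: "\<And>a x. a \<in> P \<Longrightarrow> x \<in> Obj (cat_at F a) \<Longrightarrow> hom_apply G k (a, x) = 0"
    and "a \<in> P"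
  shows "\<forall>x\<in>Obj (cat_at F a). hom_apply (cat_at F a) (\<lambda>y. k (a, y)) x = 0"
  using wf_strictly_above[OF finite_P po] \<open>a \<in> P\<close>
proof (induction a rule: wf_induct_rule)
  case (less a)
  show ?case
  proof
    fix x assume x: "x \<in> Obj (cat_at F a)"
    let ?h = "\<lambda>b. hom_apply (cat_at F b) (\<lambda>y. k (b, y)) (on_obj (func_at F a b (a, b)) x)"
    have "?h b = 0" if "(b, a) \<in> strictly_above P r" for b
      using less.IH[OF that] transport_in_Obj[of a b x] that x by (auto simp: strictly_above_def)
    then have "?h a = (\<Sum>b | b \<in> P \<and> (a, b) \<in> r. ?h b)"
      by (simp add: sum_up_set[OF finite_P po less.prems])
    also have "\<dots> = 0"
      using k[OF less.prems x] hom_apply_grothendieck[OF finite_P finite_Obj] by simp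
    finally show "hom_apply (cat_at F a) (\<lambda>y. k (a, y)) x = 0"
      by (simp add: hom_apply_transport_self[OF less.prems x])
  qed
qed

text \<open>
  Summing over a fibre \<open>F(b)\<close> in row \<open>(a, x)\<close> leaves \<open>w b\<close> for \<open>b \<ge> a\<close>, and these add up to 1.
  Orthogonality to the kernel is checked fibre by fibre, where kernel elements of \<open>[G(F)]\<close>
  become kernel elements of \<open>[F(a)]\<close>.
\<close>

lemma least_weighting_grothendieck:
  assumes w: "\<And>a. a \<in> P \<Longrightarrow> (\<Sum>b | b \<in> P \<and> (a, b) \<in> r. w b) = 1"
    and u: "\<And>a. a \<in> P \<Longrightarrow> least_weighting (cat_at F a) (u a)"
  shows "least_weighting G (\<lambda>(a, x). w a * u a x)"
  unfolding least_weighting_def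
proof (intro conjI allI impI)
  show "\<forall>c\<in>Obj G. hom_apply G (\<lambda>(a, x). w a * u a x) c = 1"
  proof (clarsimp simp: Obj_grothendieck_poset)
    fix a x assume a: "a \<in> P" and x: "x \<in> Obj (cat_at F a)"
    have "hom_apply (cat_at F b) (\<lambda>y. w b * u b y) (on_obj (func_at F a b (a, b)) x) = w b"
      if "b \<in> P" "(a, b) \<in> r" for b
    proof -
      have "hom_apply (cat_at F b) (\<lambda>y. w b * u b y) z = w b * hom_apply (cat_at F b) (u b) z" for z
        by (simp add: hom_apply_def sum_distrib_left mult.left_commute)
      then show ?thesis
        using u[OF that(1)] transport_in_Obj[OF a that x] by (simp add: least_weighting_def)
    qed
    then show "hom_apply G (\<lambda>(a, x). w a * u a x) (a, x) = 1"
      by (simp add: hom_apply_grothendieck[OF finite_P finite_Obj] w[OF a])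
  qed
next
  fix k assume k: "\<forall>c\<in>Obj G. hom_apply G k c = 0"
  have fib: "(\<Sum>y\<in>Obj (cat_at F a). u a y * k (a, y)) = 0" if "a \<in> P" for a
  proof -
    have "\<forall>x\<in>Obj (cat_at F a). hom_apply (cat_at F a) (\<lambda>y. k (a, y)) x = 0"
      by (rule kernel_restricts_to_fibres[OF _ that]) (use k in \<open>auto simp: Obj_grothendieck_poset\<close>)
    then show ?thesis using u[OF that] unfolding least_weighting_def by blast
  qed
  have "(\<Sum>c\<in>Obj G. (case c of (a, x) \<Rightarrow> w a * u a x) * k c) =
      (\<Sum>a\<in>P. \<Sum>y\<in>Obj (cat_at F a). w a * (u a y * k (a, y)))"
    unfolding Obj_grothendieck_poset
    using finite_P finite_Obj by (subst sum.Sigma) (auto intro!: sum.cong simp: mult.assoc)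
  also have "\<dots> = (\<Sum>a\<in>P. w a * (\<Sum>y\<in>Obj (cat_at F a). u a y * k (a, y)))"
    by (simp add: sum_distrib_left)
  also have "\<dots> = 0" by (simp add: fib)
  finally show "(\<Sum>c\<in>Obj G. (case c of (a, x) \<Rightarrow> w a * u a x) * k c) = 0" .
qed

lemma euler_char_grothendieck:
  assumes w: "\<And>a. a \<in> P \<Longrightarrow> (\<Sum>b | b \<in> P \<and> (a, b) \<in> r. w b) = 1"
    and u: "\<And>a. a \<in> P \<Longrightarrow> least_weighting (cat_at F a) (u a)"
  shows "euler_char G = (\<Sum>a\<in>P. euler_char (cat_at F a) * w a)"
proof -
  have "finite (Obj G)"
    using finite_P finite_Obj by (auto simp: Obj_grothendieck_poset)
  then have "euler_char G = (\<Sum>(a, x)\<in>Obj G. w a * u a x)"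
    by (rule euler_char_eq_sum) (rule least_weighting_grothendieck[OF w u])
  also have "\<dots> = (\<Sum>a\<in>P. \<Sum>x\<in>Obj (cat_at F a). w a * u a x)"
    unfolding Obj_grothendieck_poset
    using finite_P finite_Obj by (subst sum.Sigma) auto
  also have "\<dots> = (\<Sum>a\<in>P. euler_char (cat_at F a) * w a)"
  proof (rule sum.cong)
    fix a assume "a \<in> P"
    then have "euler_char (cat_at F a) = (\<Sum>x\<in>Obj (cat_at F a). u a x)"
      by (intro euler_char_eq_sum finite_Obj u)
    then show "(\<Sum>x\<in>Obj (cat_at F a). w a * u a x) = euler_char (cat_at F a) * w a"
      by (simp add: sum_distrib_left mult.commute)
  qed simp
  finally show ?thesis .
qed

end

theorem theorem2p15:
  fixes P :: "'a set" and r :: "('a \<times> 'a) set" and as :: "'a list"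
    and F :: "('a, 'a \<times> 'a, 'o, 'm) pseudofunc"
  assumes "finite P" and "partial_order_on P r"
    and "enumerates as P"
    and "pseudofunctor (poset_category P r) F"
    and "\<And>a. a \<in> P \<Longrightarrow> finite_category (cat_at F a)"
    and "\<And>a. a \<in> P \<Longrightarrow>
           \<exists>w. weighting (hom_matrix (cat_at F a) (obj_list (cat_at F a))) w"
  shows "euler_char (grothendieck (poset_category P r) F) =
    (euler_char_row F as * mp_inverse (hom_matrix (poset_category P r) as) * ones (card P))
      $$ (0, 0)"
proof -
  have fin: "finite (Obj (cat_at F a))" if "a \<in> P" for a
    using assms(5)[OF that] by (rule finite_category.finite_objects)
  interpret finite_poset_pseudofunctor P r F
    by (rule finite_poset_pseudofunctor.intro[OF assms(1,2,4) fin])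
  let ?A = "poset_category P r" and ?n = "length as"
  define Z where "Z = mp_inverse (hom_matrix ?A as)"
  have as: "enumerates as (Obj ?A)" using assms(3) by (simp add: poset_category_def)
  have n: "card P = ?n" using assms(3) by (metis distinct_card enumerates_def)
  have "\<exists>u. least_weighting (cat_at F a) u" if a: "a \<in> P" for a
    using assms(6)[OF a] least_weighting_mp_inverse[OF enumerates_obj_list[OF fin[OF a]]] by metis
  then obtain u where u: "\<And>a. a \<in> P \<Longrightarrow> least_weighting (cat_at F a) (u a)" by metis
  obtain w0 :: "'a \<Rightarrow> rat" where w0: "\<And>a. a \<in> P \<Longrightarrow> (\<Sum>b | b \<in> P \<and> (a, b) \<in> r. w0 b) = 1"
    by (rule poset_weighting_exists[OF assms(1,2)]) blast
  \<comment> \<open>the entries of \<open>[A]\<^sup>+ 1\<close> are again a weighting of the poset\<close>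
  have "weighting (hom_matrix ?A as) (mat ?n 1 (\<lambda>(i, j). w0 (as ! i)))"
    using w0 by (intro weighting_hom_matrix[OF as])
      (simp add: hom_apply_poset_category[OF finite_P], simp add: poset_category_def)
  then obtain w where "least_weighting ?A w"
    and wZ: "\<And>i. i < ?n \<Longrightarrow> w (as ! i) = (Z * ones ?n) $$ (i, 0)"
    unfolding Z_def by (rule least_weighting_mp_inverse[OF as]) blast
  then have w: "(\<Sum>b | b \<in> P \<and> (a, b) \<in> r. w b) = 1" if "a \<in> P" for a
    using that
    by (simp add: least_weighting_def hom_apply_poset_category[OF finite_P])
      (simp add: poset_category_def)
  have "dim_row Z = ?n" "dim_col Z = ?n"
    using is_mp_inverse_mp_inverse[of "hom_matrix ?A as"]
    by (auto simp: Z_def is_mp_inverse_def hom_matrix_def)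
  then have "(euler_char_row F as * Z * ones ?n) $$ (0, 0) =
      (\<Sum>i<?n. euler_char_row F as $$ (0, i) * (Z * ones ?n) $$ (i, 0))"
    by (subst mult_assoc_dim, simp_all add: euler_char_row_def ones_def del: index_mult_mat(1))
      (subst index_mult_sum, simp_all del: index_mult_mat(1))
  also have "\<dots> = (\<Sum>i<?n. euler_char (cat_at F (as ! i)) * w (as ! i))"
    by (intro sum.cong) (simp_all add: wZ euler_char_row_def)
  also have "\<dots> = (\<Sum>a\<in>P. euler_char (cat_at F a) * w a)"
    by (simp add: sum_enumerates[OF assms(3)])
  also have "\<dots> = euler_char G"
    by (rule euler_char_grothendieck[OF w u, symmetric])
  finally show ?thesis by (simp add: Z_def n)
qed

end
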